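(* Let $d\ge 1$, let $f:\mathbb{R}^d\to\mathbb{R}$ be a $\mathcal{C}^1$ function, and suppose that $m>0$, $\sigma>0$, $r>0$ and (finite) $L>m$ satisfy $$\frac{2\sigma}{3}<r<\sigma,\qquad m\ge 8r^2-10r\sigma+4\sigma^2,$$ $$L\le m+\frac{2(\sigma-r)}{3r-2\sigma}\cdot\max\left(m-4r\sigma+4r^2,\;2m-4r\sigma+2r^2\right).$$ If $\nabla f$ belongs to the sector $[m,L]$ and $f$ is $m$-quasi-strongly convex, then the system $$\dot q = p,\qquad \dot p=-2\sigma p-\nabla f(q)$$ on $\mathbb{R}^{2d}\ni z=(q,p)$ is $r$-exponentially stable.
   Context: Sector: for $m<L\le\infty$, a continuous function $\phi:\mathbb{R}^n\to\mathbb{R}^n$ belongs to the sector $[m,L]$ if $\langle mw-\phi(w),\,w-L^{-1}\phi(w)\rangle\le 0$ for all $w\in\mathbb{R}^n$, where $L^{-1}=0$ if $L=\infty$. Quasi-strong convexity: a $\mathcal{C}^1$ function $f:\mathbb{R}^n\to\mathbb{R}$ is $m$-quasi-strongly convex (with respect to the origin) if $\nabla f$ belongs to the sector $[m,\infty]$ and $f(w)-\langle\nabla f(w),w\rangle+\frac m2|w|^2\le f(0)$ for all $w\in\mathbb{R}^n$. Exponential stability: an autonomous system $\dot z=F(z)$ with $F$ continuous is $r$-exponentially stable ($r\ge0$) if $z=0$ is an equilibrium point and there is an increasing continuous function $\kappa:[0,\infty)\to[0,\infty)$ with $\kappa(0)=0$ such that $|z(t)|\le\kappa(|z(0)|)\,e^{-rt}$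 for each solution $z$ and every $t\ge0$ for which $z$ exists. *)

theory Defs
  imports "HOL-Analysis.Analysis"
begin

definition grad :: "('a::euclidean_space \<Rightarrow> real) \<Rightarrow> 'a \<Rightarrow> 'a" where
  "grad f x = (THE D. GDERIV f x :> D)"

definition C1 :: "('a::euclidean_space \<Rightarrow> real) \<Rightarrow> bool" where
  "C1 f \<longleftrightarrow> (\<forall>x. GDERIV f x :> grad f x) \<and> continuous_on UNIV (grad f)"

(* The upper bound L may be infinite; inverse \<infinity> = 0 in ereal. *)
definition sector :: "real \<Rightarrow> ereal \<Rightarrow> ('a::euclidean_space \<Rightarrow> 'a) set" where
  "sector m L = {\<phi>. ereal m < L \<and> continuous_on UNIV \<phi> \<and>
     (\<forall>w. inner (m *\<^sub>R w - \<phi> w) (w - real_of_ereal (inverse L) *\<^sub>R \<phi> w) \<le> 0)}"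

definition quasi_strongly_convex :: "real \<Rightarrow> ('a::euclidean_space \<Rightarrow> real) \<Rightarrow> bool" where
  "quasi_strongly_convex m f \<longleftrightarrow> C1 f \<and> grad f \<in> sector m \<infinity> \<and>
     (\<forall>w. f w - inner (grad f w) w + m / 2 * (norm w)\<^sup>2 \<le> f 0)"

(* z solves z' = F(z) on the interval J, which contains the initial time 0 and may be
   open, closed, half-open, bounded or unbounded. Derivatives at an endpoint belonging
   to J are one-sided. *)
definition ode_solution :: "('a::euclidean_space \<Rightarrow> 'a) \<Rightarrow> real set \<Rightarrow> (real \<Rightarrow> 'a) \<Rightarrow> bool" where
  "ode_solution F J z \<longleftrightarrow> is_interval J \<and> 0 \<in> J \<and> J \<noteq> {0} \<and>
     (\<forall>t\<in>J. (z has_vector_derivative F (z t)) (at t within J))"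

(* F is not assumed Lipschitz, so solutions may be non-unique and need not be global:
   the same \<kappa> must serve all solutions, on their intervals of existence. *)
definition exponentially_stable :: "real \<Rightarrow> ('a::euclidean_space \<Rightarrow> 'a) \<Rightarrow> bool" where
  "exponentially_stable r F \<longleftrightarrow> r \<ge> 0 \<and> continuous_on UNIV F \<and> F 0 = 0 \<and>
     (\<exists>\<kappa>::real \<Rightarrow> real. \<kappa> \<in> {0..} \<rightarrow> {0..} \<and> strict_mono_on {0..} \<kappa> \<and>
        continuous_on {0..} \<kappa> \<and> \<kappa> 0 = 0 \<and>
        (\<forall>J z. ode_solution F J z \<longrightarrow>
           (\<forall>t\<in>J. t \<ge> 0 \<longrightarrow> norm (z t) \<le> \<kappa> (norm (z 0)) * exp (- r * t))))"

end

theory Submission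
  imports Defs
begin

text \<open>
  Put h(q) = f(q) - f(0) - m/2 |q|^2, u = grad h and P = p + r q. Quasi-strong convexity and the
  sector condition give 0 \<le> h \<le> <u,q>, |u|^2 \<le> K <u,q> and h \<le> K/2 |q|^2, where K = L - m.
  The function V = A |q|^2 + 2 B <q,P> + C |P|^2 + 2 \<nu> h satisfies V' \<le> -2 r V for suitable
  coefficients. For each of the two terms of the maximum in the bound on L there is one choice:
  the first uses the sector condition, with the coefficients from the spectral factorisation of
  the frequency-domain inequality, and the second uses a convex combination of the
  two upper bounds on h.
\<close>

section \<open>Lyapunov criterion for exponential stability\<close>

text \<open>Along every solution e^(2rt) V(z(t)) is nonincreasing, and the quadratic bounds on
  \<open>V\<close> turn this into a bound on |z(t)|. The resulting \<open>\<kappa>\<close> is linear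
  with slope sqrt(C/c), so it depends neither on the solution nor on its interval; uniqueness of
  solutions does not enter. Here \<open>V' z (F z)\<close> is the derivative of \<open>V\<close>
  along the vector field.\<close>

lemma exponentially_stableI:
  fixes F :: "'a::euclidean_space \<Rightarrow> 'a" and V :: "'a \<Rightarrow> real"
  assumes r: "r \<ge> 0" and cont: "continuous_on UNIV F" and F0: "F 0 = 0"
    and V: "\<And>z. (V has_derivative V' z) (at z)"
    and decay: "\<And>z. V' z (F z) \<le> - 2 * r * V z"
    and lower: "\<And>z. c * (norm z)\<^sup>2 \<le> V z"
    and upper: "\<And>z. V z \<le> C * (norm z)\<^sup>2"
    and c: "c > 0" and C: "C > 0"
  shows "exponentially_stable r F"
proof -
  define \<kappa> where "\<kappa> x = sqrt (C / c) * x" for x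
  have pos: "sqrt (C / c) > 0" using c C by simp
  have bound: "norm (z t) \<le> \<kappa> (norm (z 0)) * exp (- r * t)"
    if sol: "ode_solution F J z" and t: "t \<in> J" "t \<ge> 0" for J z t
  proof -
    define W where "W x = exp (2 * r * x) * V (z x)" for x
    have J: "{0..t} \<subseteq> J"
    proof
      fix x assume "x \<in> {0..t}"
      moreover have "is_interval J" "0 \<in> J" using sol by (simp_all add: ode_solution_def)
      ultimately show "x \<in> J" using t(1) mem_is_interval_1_I[of J 0 t x] by simp
    qed
    have W': "(W has_real_derivative exp (2 * r * x) * (2 * r * V (z x) + V' (z x) (F (z x))))
        (at x within {0..t})" if "x \<in> {0..t}" for x
    proof -
      have z: "(z has_vector_derivative F (z x)) (at x within {0..t})"
        by (rule has_vector_derivative_within_subset[OF _ J])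
          (use sol that J in \<open>auto simp: ode_solution_def\<close>)
      have "((V \<circ> z) has_vector_derivative V' (z x) (F (z x))) (at x within {0..t})"
        by (rule vector_derivative_diff_chain_within[OF z has_derivative_at_withinI[OF V]])
      then have "((\<lambda>x. V (z x)) has_real_derivative V' (z x) (F (z x))) (at x within {0..t})"
        by (simp add: has_real_derivative_iff_has_vector_derivative o_def)
      then show ?thesis
        unfolding W_def by (auto intro!: derivative_eq_intros simp: algebra_simps)
    qed
    \<comment> \<open>The monotonicity rule asks for derivatives at interior points and for
      continuity on the closed interval, so the one-sided derivatives at 0 and t are enough.\<close>
    have "W t \<le> W 0"
    proof (rule DERIV_nonpos_imp_decreasing_open[OF t(2)])
      fix x assume x: "0 < x" "x < t"
      have "(W has_real_derivative exp (2 * r * x) * (2 * r * V (z x) + V' (z x) (F (z x)))) (at x)"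
        using W'[of x] x by (simp add: at_within_Icc_at)
      moreover have "exp (2 * r * x) * (2 * r * V (z x) + V' (z x) (F (z x))) \<le> 0"
        using decay[of "z x"] by (intro mult_nonneg_nonpos) simp_all
      ultimately show "\<exists>y. (W has_real_derivative y) (at x) \<and> y \<le> 0" by blast
    next
      show "continuous_on {0..t} W" by (rule DERIV_continuous_on[OF W'])
    qed
    then have "exp (2 * r * t) * V (z t) \<le> V (z 0)" by (simp add: W_def)
    then have "exp (2 * r * t) * (c * (norm (z t))\<^sup>2) \<le> C * (norm (z 0))\<^sup>2"
      using mult_left_mono[OF lower[of "z t"] exp_ge_zero] upper[of "z 0"] by (meson order_trans)
    moreover have "exp (2 * r * t) = (exp (r * t))\<^sup>2"
      by (simp add: power2_eq_square flip: exp_add)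
    ultimately have "(exp (r * t) * norm (z t))\<^sup>2 \<le> (C / c) * (norm (z 0))\<^sup>2"
      using c by (simp add: field_simps power_mult_distrib)
    then have "exp (r * t) * norm (z t) \<le> sqrt ((C / c) * (norm (z 0))\<^sup>2)"
      by (rule real_le_rsqrt)
    then have "exp (r * t) * norm (z t) \<le> \<kappa> (norm (z 0))"
      by (simp only: \<kappa>_def real_sqrt_mult real_sqrt_abs abs_norm_cancel)
    then show ?thesis by (simp add: exp_minus field_simps)
  qed
  show ?thesis
    unfolding exponentially_stable_def
  proof (intro conjI exI[of _ \<kappa>] allI impI ballI)
    show "\<kappa> \<in> {0..} \<rightarrow> {0..}" "\<kappa> 0 = 0" using pos by (auto simp: \<kappa>_def)
    show "strict_mono_on {0..} \<kappa>" using pos by (auto simp: \<kappa>_def intro!: strict_mono_onI)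
    show "continuous_on {0..} \<kappa>" unfolding \<kappa>_def by (intro continuous_intros)
  qed (fact r cont F0 bound)+
qed

section \<open>Quadratic forms and comparison of norms\<close>

lemma quadratic_form_bounds:
  fixes q P :: "'a::real_inner"
  assumes "A > 0" "C > 0" "A * C > B\<^sup>2"
  shows "(A * C - B\<^sup>2) / (A + C) * (inner q q + inner P P)
           \<le> A * inner q q + 2 * B * inner q P + C * inner P P"
    and "A * inner q q + 2 * B * inner q P + C * inner P P
           \<le> (A + C) * (inner q q + inner P P)"
proof -
  have lower: "(A * C - B\<^sup>2) / (A + C) * (inner x x + inner y y)
      \<le> A * inner x x + 2 * B * inner x y + C * inner y y" 
    if "A > 0" "C > 0" for A B C and x y :: 'a
  proof -
    \<comment> \<open>Cayley-Hamilton for G = [[A, B], [B, C]]: G^2 = (tr G) G - (det G) I. Thus 0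
      \<le> |G(x, y)|^2 is trace times form minus determinant times squared norm.\<close>
    have "0 \<le> inner (A *\<^sub>R x + B *\<^sub>R y) (A *\<^sub>R x + B *\<^sub>R y)
        + inner (B *\<^sub>R x + C *\<^sub>R y) (B *\<^sub>R x + C *\<^sub>R y)"
      by simp
    also have "\<dots> = (A + C) * (A * inner x x + 2 * B * inner x y + C * inner y y)
        - (A * C - B\<^sup>2) * (inner x x + inner y y)"
      by (simp add: inner_add_left inner_add_right inner_commute[of y x] power2_eq_square
          algebra_simps)
    finally show ?thesis using that by (simp add: field_simps)
  qed
  show "(A * C - B\<^sup>2) / (A + C) * (inner q q + inner P P)
      \<le> A * inner q q + 2 * B * inner q P + C * inner P P"
    using lower assms by blast
  \<comment> \<open>The upper bound is the lower bound for the adjugate (tr G) I - G = [[C, -B],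
    [-B, A]], which has the same determinant and trace.\<close>
  have "0 \<le> (C * A - (- B)\<^sup>2) / (C + A) * (inner q q + inner P P)"
    using assms by (simp add: mult.commute)
  also have "\<dots> \<le> C * inner q q + 2 * (- B) * inner q P + A * inner P P"
    using lower assms by blast
  finally show "A * inner q q + 2 * B * inner q P + C * inner P P
      \<le> (A + C) * (inner q q + inner P P)"
    by (simp add: algebra_simps)
qed

lemma sheared_norm_bounds:
  fixes q p :: "'a::real_inner"
  shows "inner q q + inner p p
           \<le> (2 + 2 * r\<^sup>2) * (inner q q + inner (p + r *\<^sub>R q) (p + r *\<^sub>R q))"
    and "inner q q + inner (p + r *\<^sub>R q) (p + r *\<^sub>R q)
           \<le> (2 + 2 * r\<^sup>2) * (inner q q + inner p p)"
proof -
  have shear: "inner q q + inner (y + c *\<^sub>R q) (y + c *\<^sub>R q)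
      \<le> (2 + 2 * c\<^sup>2) * (inner q q + inner y y)" for y c
  proof -
    \<comment> \<open>The parallelogram law: 2 |y|^2 + 2 c^2 |q|^2 - |y + c q|^2 = |y - c
      q|^2.\<close>
    have "0 \<le> inner (y - c *\<^sub>R q) (y - c *\<^sub>R q) + inner q q + 2 * c\<^sup>2 * inner y y" by simp
    also have "\<dots> = (2 + 2 * c\<^sup>2) * (inner q q + inner y y)
        - (inner q q + inner (y + c *\<^sub>R q) (y + c *\<^sub>R q))"
      by (simp add: inner_add_left inner_add_right inner_diff_left inner_diff_right
          inner_commute[of y q] power2_eq_square algebra_simps)
    finally show ?thesis by simp
  qed
  show "inner q q + inner (p + r *\<^sub>R q) (p + r *\<^sub>R q) \<le> (2 + 2 * r\<^sup>2) * (inner q q + inner p p)"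
    by (rule shear)
  \<comment> \<open>The inverse of the shear by r is the shear by -r, and the constant is even in
    r.\<close>
  show "inner q q + inner p p
      \<le> (2 + 2 * r\<^sup>2) * (inner q q + inner (p + r *\<^sub>R q) (p + r *\<^sub>R q))"
    using shear[of "p + r *\<^sub>R q" "- r"] by simp
qed

section \<open>Dissipation inequalities and choice of the Lyapunov coefficients\<close>

text \<open>In the coordinates (q, P) the system reads q' = P - r q, P' = -(r + 2s) P - M q - u, and
  the left-hand side of the conclusion is V' + 2 r V; the terms in \<open>r\<close> that come from
  the linear part cancel against 2 r V. The coefficients are chosen so that, once the sector
  inequality is added with weight \<open>\<delta>\<close>^2, the remaining form in (q, P, u) has
  rank one. The bound M \<ge> \<open>\<delta>\<close>^2 is what makes \<open>\<nu>\<close>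
  nonnegative.\<close>

lemma dissipation_sector:
  fixes q P u :: "'a::real_inner" and s \<delta> r M K h :: real
  assumes pos: "s > 0" "\<delta> > 0" and r: "r = \<delta> + 2 * s" and M: "M \<ge> \<delta>\<^sup>2"
    and K: "\<delta> * K \<le> 2 * s * (M + r * \<delta>)"
    and h: "h \<le> inner u q" and uq: "inner u q \<ge> 0" and sec: "inner u u \<le> K * inner u q"
    and A: "A = s * (4 * s\<^sup>2 * M + \<delta>\<^sup>2 * M + M\<^sup>2 + 4 * s * \<delta> * M)"
    and B: "B = 2 * s\<^sup>2 * M" and C: "C = s * (\<delta>\<^sup>2 + M)" and \<nu>: "\<nu> = s * (M - \<delta>\<^sup>2)"
  shows "2 * A * inner q P
      + 2 * B * (inner P P - 2 * s * inner q P - M * inner q q - inner u q)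
      + 2 * C * (- 2 * s * inner P P - M * inner q P - inner u P)
      + 2 * \<nu> * (inner u P - r * inner u q + 2 * r * h) \<le> 0"
    (is "?D + 2 * \<nu> * (?w + 2 * r * h) \<le> 0")
proof -
  have "\<nu> \<ge> 0" "r \<ge> 0" using pos M by (auto simp: \<nu> r)
  then have "2 * \<nu> * (?w + 2 * r * h) \<le> 2 * \<nu> * (?w + 2 * r * inner u q)"
    using h by (intro mult_left_mono add_left_mono) auto
  moreover have "\<delta>\<^sup>2 * inner u u \<le> 2 * s * \<delta> * (M + r * \<delta>) * inner u q"
  proof -
    have "\<delta>\<^sup>2 * inner u u \<le> \<delta>\<^sup>2 * (K * inner u q)"
      using sec by (intro mult_left_mono) auto
    also have "\<dots> = \<delta> * inner u q * (\<delta> * K)" by (simp add: power2_eq_square)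
    also have "\<dots> \<le> \<delta> * inner u q * (2 * s * (M + r * \<delta>))"
      using K uq pos by (intro mult_left_mono) auto
    finally show ?thesis by (simp add: algebra_simps)
  qed
  \<comment> \<open>With h replaced by its bound <u,q>, adding the nonnegative sector term leaves
    exactly minus a square.\<close>
  moreover have "?D + 2 * \<nu> * (?w + 2 * r * inner u q)
      + 2 * s * \<delta> * (M + r * \<delta>) * inner u q - \<delta>\<^sup>2 * inner u u
      = - inner (\<delta> *\<^sub>R u - (2 * s * M) *\<^sub>R q + (2 * s * \<delta>) *\<^sub>R P)
          (\<delta> *\<^sub>R u - (2 * s * M) *\<^sub>R q + (2 * s * \<delta>) *\<^sub>R P)"
    unfolding A B C \<nu> r
    by (simp add: inner_add_left inner_add_right inner_diff_left inner_diff_right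
        inner_commute[of q u] inner_commute[of P u] inner_commute[of P q] power2_eq_square
        algebra_simps)
  moreover have "- inner x x \<le> 0" for x :: 'a by simp
  ultimately show ?thesis by (smt (verit))
qed

text \<open>With these coefficients all terms in <q,P>, |P|^2 and <u,P> cancel, leaving -4 s M |q|^2
  - (4r - 2\<open>\<delta>\<close>) <u,q> + 4 r h. Splitting 4 r h as (4r -
  2\<open>\<delta>\<close>) h + 2\<open>\<delta>\<close> h and using one upper bound on h for each
  share absorbs both negative terms.\<close>

lemma dissipation_quadratic_bound:
  fixes q P u :: "'a::real_inner" and s \<delta> r M K h :: real
  assumes pos: "s > 0" "\<delta> > 0" and r: "r = \<delta> + 2 * s"
    and K: "\<delta> * K \<le> 4 * s * M"
    and h: "h \<le> inner u q" "h \<le> K / 2 * inner q q"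
  shows "2 * (M + 4 * s\<^sup>2) * inner q P
      + 2 * (2 * s) * (inner P P - 2 * s * inner q P - M * inner q q - inner u q)
      + 2 * (- 2 * s * inner P P - M * inner q P - inner u P)
      + 2 * (inner u P - r * inner u q + 2 * r * h) \<le> 0"
proof -
  have "(4 * r - 2 * \<delta>) * h \<le> (4 * r - 2 * \<delta>) * inner u q"
    using h(1) pos r by (intro mult_left_mono) auto
  moreover have "2 * \<delta> * h \<le> 2 * \<delta> * (K / 2 * inner q q)"
    using h(2) pos by (intro mult_left_mono) auto
  moreover have "\<delta> * K * inner q q \<le> 4 * s * M * inner q q"
    using K by (intro mult_right_mono) auto
  ultimately show ?thesis by (simp add: r power2_eq_square algebra_simps)
qed

lemma lyapunov_coefficients:
  fixes s \<delta> r M K :: real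
  assumes pos: "s > 0" "\<delta> > 0" and r: "r = \<delta> + 2 * s" and M: "M \<ge> \<delta>\<^sup>2"
    and K: "\<delta> * K \<le> 2 * s * max (M + r * \<delta>) (2 * M)"
  obtains A B C \<nu> where "A > 0" "C > 0" "A * C > B\<^sup>2" "\<nu> \<ge> 0"
    "\<And>(q::'a::real_inner) P u h. h \<le> inner u q \<Longrightarrow> h \<le> K / 2 * inner q q \<Longrightarrow> inner u q \<ge> 0 \<Longrightarrow>
      inner u u \<le> K * inner u q \<Longrightarrow>
      2 * A * inner q P + 2 * B * (inner P P - 2 * s * inner q P - M * inner q q - inner u q)
      + 2 * C * (- 2 * s * inner P P - M * inner q P - inner u P)
      + 2 * \<nu> * (inner u P - r * inner u q + 2 * r * h) \<le> 0"
proof (cases "\<delta> * K \<le> 2 * s * (M + r * \<delta>)")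
  case True
  define A where "A = s * (4 * s\<^sup>2 * M + \<delta>\<^sup>2 * M + M\<^sup>2 + 4 * s * \<delta> * M)"
  define B where "B = 2 * s\<^sup>2 * M"
  define C where "C = s * (\<delta>\<^sup>2 + M)"
  have "M > 0" using M pos by (smt (verit) zero_less_power)
  show ?thesis
  proof (rule that[of A C B "s * (M - \<delta>\<^sup>2)"])
    show "A > 0" "C > 0" using pos \<open>M > 0\<close> by (auto simp: A_def C_def add_pos_pos)
    \<comment> \<open>The terms 4 s^4 M^2 cancel, so only positive summands remain.\<close>
    have "A * C - B\<^sup>2 = s\<^sup>2 * (4 * s\<^sup>2 * M * \<delta>\<^sup>2 + (\<delta>\<^sup>2 * M + M\<^sup>2 + 4 * s * \<delta> * M) * (\<delta>\<^sup>2 + M))"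
      by (simp add: A_def B_def C_def power2_eq_square algebra_simps)
    also have "\<dots> > 0"
      using pos \<open>M > 0\<close> by (intro mult_pos_pos add_pos_pos) auto
    finally show "A * C > B\<^sup>2" by simp
    show "s * (M - \<delta>\<^sup>2) \<ge> 0" using pos M by simp
  qed (rule dissipation_sector[OF pos r M True]; simp add: A_def B_def C_def)
next
  case False
  \<comment> \<open>As the first alternative fails, the maximum has to be 2 M.\<close>
  then have K': "\<delta> * K \<le> 4 * s * M"
    using K by (auto simp: max_def split: if_splits)
  have "M > 0" using M pos by (smt (verit) zero_less_power)
  show ?thesis
  \<comment> \<open>These coefficients give V = |P + 2 s q|^2 + M |q|^2 + 2 h, whose quadratic part
    has determinant M.\<close>
  proof (rule that[of "M + 4 * s\<^sup>2" 1 "2 * s" 1])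
    show "M + 4 * s\<^sup>2 > 0" "(M + 4 * s\<^sup>2) * 1 > (2 * s)\<^sup>2"
      using \<open>M > 0\<close> by (auto simp: add_pos_nonneg power_mult_distrib)
  next
    fix q P u :: 'a and h
    assume "h \<le> inner u q" "h \<le> K / 2 * inner q q"
    from dissipation_quadratic_bound[OF pos r K' this]
    show "2 * (M + 4 * s\<^sup>2) * inner q P
      + 2 * (2 * s) * (inner P P - 2 * s * inner q P - M * inner q q - inner u q)
      + 2 * 1 * (- 2 * s * inner P P - M * inner q P - inner u P)
      + 2 * 1 * (inner u P - r * inner u q + 2 * r * h) \<le> 0" by (simp only: mult_1_right)
  qed auto
qed

section \<open>Sector condition and bounds on the potential\<close>

lemma sector_inner_le:
  fixes u w :: "'a::real_inner"
  assumes "inner u u \<le> K * inner u w" and K: "K > 0"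
  shows "inner u w \<ge> 0" and "inner u w \<le> K * inner w w"
proof -
  show "inner u w \<ge> 0"
    using order_trans[OF inner_ge_zero assms(1)] K by (simp add: zero_le_mult_iff)
  have "0 \<le> inner (u - K *\<^sub>R w) (u - K *\<^sub>R w)" by simp
  also have "\<dots> \<le> K * (K * inner w w - inner u w)"
    using assms(1) by (simp add: inner_diff_left inner_diff_right inner_commute[of w u] algebra_simps)
  finally show "inner u w \<le> K * inner w w"
    using K by (simp add: zero_le_mult_iff)
qed

text \<open>Both bounds come from integrating along the ray from 0 to x: the derivative of h(t x) in
  t lies between 0 and K t |x|^2.\<close>

lemma potential_bounds:
  fixes h :: "'a::euclidean_space \<Rightarrow> real"
  assumes h: "\<And>x. GDERIV h x :> u x" and "h 0 = 0" and K: "K > 0"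
    and sec: "\<And>x. inner (u x) (u x) \<le> K * inner (u x) x"
  shows "h x \<ge> 0" and "h x \<le> K / 2 * inner x x"
proof -
  have der: "((\<lambda>t. h (t *\<^sub>R x)) has_real_derivative inner (u (t *\<^sub>R x)) x) (at t)" for t
  proof -
    have "((\<lambda>t. t *\<^sub>R x) has_vector_derivative x) (at t)"
      by (auto intro!: derivative_eq_intros)
    from vector_derivative_diff_chain_within[OF this, of h "\<lambda>v. inner v (u (t *\<^sub>R x))"]
    show ?thesis
      using h[of "t *\<^sub>R x"] unfolding gderiv_def
      by (simp add: has_derivative_at_withinI has_real_derivative_iff_has_vector_derivative
          o_def inner_commute)
  qed
  \<comment> \<open>The sector condition at t x carries an extra factor t, which can be divided out
    only for t > 0; the two monotonicity arguments therefore work on the open interval.\<close>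
  have nonneg: "inner (u (t *\<^sub>R x)) x \<ge> 0" and le: "inner (u (t *\<^sub>R x)) x \<le> K * t * inner x x"
    if "t > 0" for t
  proof -
    have "t * inner (u (t *\<^sub>R x)) x \<ge> 0"
      using sector_inner_le(1)[OF sec[of "t *\<^sub>R x"] K] by simp
    then show "inner (u (t *\<^sub>R x)) x \<ge> 0" using that by (simp add: zero_le_mult_iff)
    have "t * inner (u (t *\<^sub>R x)) x \<le> t * (K * t * inner x x)"
      using sector_inner_le(2)[OF sec[of "t *\<^sub>R x"] K] by (simp add: mult_ac)
    then show "inner (u (t *\<^sub>R x)) x \<le> K * t * inner x x" using that by simp
  qed
  have cont: "continuous_on {0..1} (\<lambda>t. h (t *\<^sub>R x))"
    using der DERIV_isCont continuous_at_imp_continuous_on by blast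
  have "h (0 *\<^sub>R x) \<le> h (1 *\<^sub>R x)"
    by (rule DERIV_nonneg_imp_increasing_open[of 0 1 "\<lambda>t. h (t *\<^sub>R x)"])
      (use der nonneg cont in auto)
  then show "h x \<ge> 0" using \<open>h 0 = 0\<close> by simp
  \<comment> \<open>The second bound says that h minus its quadratic majorant does not increase
    along the ray.\<close>
  define g where "g t = h (t *\<^sub>R x) - K / 2 * t\<^sup>2 * inner x x" for t
  have "g 1 \<le> g 0"
  proof (rule DERIV_nonpos_imp_decreasing_open[of 0 1 g])
    fix t :: real assume "0 < t" "t < 1"
    have "(g has_real_derivative inner (u (t *\<^sub>R x)) x - K * t * inner x x) (at t)"
      unfolding g_def by (auto intro!: derivative_eq_intros der)
    then show "\<exists>y. (g has_real_derivative y) (at t) \<and> y \<le> 0"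
      using le[OF \<open>0 < t\<close>] by (intro exI conjI) auto
  next
    show "continuous_on {0..1} g" unfolding g_def by (intro continuous_intros cont)
  qed auto
  then show "h x \<le> K / 2 * inner x x" using \<open>h 0 = 0\<close> by (simp add: g_def)
qed

section \<open>Application to the damped system\<close>

theorem theorem2:
  fixes f :: "real ^ 'd \<Rightarrow> real" and m \<sigma> r L :: real
  assumes "C1 f"
    and "m > 0" and "\<sigma> > 0" and "r > 0" and "L > m"
    and "2 * \<sigma> / 3 < r" and "r < \<sigma>"
    and "m \<ge> 8 * r\<^sup>2 - 10 * r * \<sigma> + 4 * \<sigma>\<^sup>2"
    and "L \<le> m + 2 * (\<sigma> - r) / (3 * r - 2 * \<sigma>) *
           max (m - 4 * r * \<sigma> + 4 * r\<^sup>2) (2 * m - 4 * r * \<sigma> + 2 * r\<^sup>2)"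
    and "grad f \<in> sector m (ereal L)"
    and "quasi_strongly_convex m f"
  shows "exponentially_stable r
           (\<lambda>(q, p). (p, - (2 * \<sigma>) *\<^sub>R p - grad f q))"
proof -
  \<comment> \<open>The bounds 2\<open>\<sigma>\<close>/3 < r < \<open>\<sigma>\<close> say that
    \<open>s\<close> and \<open>\<delta>\<close> are positive. \<open>M\<close> is the value of the
    characteristic polynomial x^2 + 2\<open>\<sigma>\<close>x + m at x = -r.\<close>
  define s \<delta> M K where "s = \<sigma> - r" and "\<delta> = 3 * r - 2 * \<sigma>"
    and "M = m - 2 * \<sigma> * r + r\<^sup>2" and "K = L - m"
  define h u where "h q = f q - f 0 - m / 2 * inner q q" and "u q = grad f q - m *\<^sub>R q" for q
  have s: "s > 0" and \<delta>: "\<delta> > 0" and K: "K > 0" and L: "L > 0" and r: "r = \<delta> + 2 * s"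
    and \<sigma>: "\<sigma> = r + s"
    using assms by (auto simp: s_def \<delta>_def K_def)
  \<comment> \<open>The difference M - \<open>\<delta>\<close>^2 equals m - (8 r^2 - 10
    r\<open>\<sigma>\<close> + 4\<open>\<sigma>\<close>^2).\<close>
  have M: "M \<ge> \<delta>\<^sup>2"
    using assms(8) by (simp add: M_def \<delta>_def power2_eq_square algebra_simps)
  have "m - 4 * r * \<sigma> + 4 * r\<^sup>2 = M + r * \<delta>" "2 * m - 4 * r * \<sigma> + 2 * r\<^sup>2 = 2 * M"
    by (simp_all add: M_def \<delta>_def power2_eq_square algebra_simps)
  then have "K \<le> 2 * s / \<delta> * max (M + r * \<delta>) (2 * M)"
    using assms(9) by (simp add: K_def s_def \<delta>_def)
  then have KM: "\<delta> * K \<le> 2 * s * max (M + r * \<delta>) (2 * M)"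
    using \<delta> by (simp add: pos_le_divide_eq mult.commute)
  have df: "GDERIV f x :> grad f x" and cont: "continuous_on UNIV (grad f)" for x
    using assms(1) by (auto simp: C1_def)
  have dh: "GDERIV h x :> u x" for x
    using df[of x] unfolding gderiv_def h_def u_def
    by (auto intro!: derivative_eq_intros simp: inner_diff_right inner_commute)
  \<comment> \<open>Multiplied by L, the second factor becomes L x - grad f x = K x - u x and the
    first is -u x, so the sector condition reads <u x, K x - u x> \<ge> 0.\<close>
  have sec: "inner (u x) (u x) \<le> K * inner (u x) x" for x
  proof -
    have "inner (m *\<^sub>R x - grad f x) (x - inverse L *\<^sub>R grad f x) \<le> 0"
      using assms(10) L by (auto simp: sector_def)
    then have "L * inner (m *\<^sub>R x - grad f x) (x - inverse L *\<^sub>R grad f x) \<le> 0"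
      using L by (simp add: mult_le_0_iff)
    also have "L * inner (m *\<^sub>R x - grad f x) (x - inverse L *\<^sub>R grad f x)
        = inner (m *\<^sub>R x - grad f x) (L *\<^sub>R (x - inverse L *\<^sub>R grad f x))"
      by simp
    also have "L *\<^sub>R (x - inverse L *\<^sub>R grad f x) = L *\<^sub>R x - grad f x"
      using L by (simp add: scaleR_diff_right)
    finally show ?thesis
      by (simp add: u_def K_def inner_diff_left inner_diff_right inner_commute algebra_simps)
  qed
  have hu: "h x \<le> inner (u x) x" for x
    using assms(11) unfolding quasi_strongly_convex_def
    by (simp add: h_def u_def inner_diff_left power2_norm_eq_inner)
      (smt (verit) field_sum_of_halves)
  have "h 0 = 0" by (simp add: h_def)
  note hb = potential_bounds[OF dh this K sec]
  have uq: "inner (u x) x \<ge> 0" for x by (rule sector_inner_le(1)[OF sec K])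
  \<comment> \<open>The sector inequality at the origin forces u 0 = 0, so the origin is an
    equilibrium.\<close>
  have "inner (u 0) (u 0) \<le> 0" using sec[of 0] by (simp only: inner_zero_right mult_zero_right)
  then have "\<not> inner (u 0) (u 0) > 0" by (simp only: not_less)
  then have "u 0 = 0" by (simp only: inner_gt_zero_iff not_not)
  then have grad0: "grad f 0 = 0" by (simp add: u_def)
  obtain A B C \<nu> where pos: "A > 0" "C > 0" "A * C > B\<^sup>2" "\<nu> \<ge> 0"
    and diss: "\<And>(q::real^'d) P u h. h \<le> inner u q \<Longrightarrow> h \<le> K / 2 * inner q q \<Longrightarrow>
      inner u q \<ge> 0 \<Longrightarrow> inner u u \<le> K * inner u q \<Longrightarrow>
      2 * A * inner q P + 2 * B * (inner P P - 2 * s * inner q P - M * inner q q - inner u q)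
      + 2 * C * (- 2 * s * inner P P - M * inner q P - inner u P)
      + 2 * \<nu> * (inner u P - r * inner u q + 2 * r * h) \<le> 0"
    by (rule lyapunov_coefficients[OF s \<delta> r M KM]) blast
  define Q where "Q q P = A * inner q q + 2 * B * inner q P + C * inner P P" for q P :: "real^'d"
  define V where "V z = Q (fst z) (snd z + r *\<^sub>R fst z) + 2 * \<nu> * h (fst z)" for z
  \<comment> \<open>The derivative of \<open>V\<close> at \<open>z\<close> in the direction
    \<open>w\<close>.\<close>
  define V' where "V' z w = 2 * A * inner (fst z) (fst w)
      + 2 * B * (inner (fst w) (snd z + r *\<^sub>R fst z) + inner (fst z) (snd w + r *\<^sub>R fst w))
      + 2 * C * inner (snd z + r *\<^sub>R fst z) (snd w + r *\<^sub>R fst w)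
      + 2 * \<nu> * inner (fst w) (u (fst z))" for z w :: "(real^'d) \<times> (real^'d)"
  \<comment> \<open>\<open>c\<close> is determinant over trace of the form, divided by the shear
    constant. \<open>E\<close> is the trace times the shear constant, plus \<open>\<nu> * K\<close>
    from 2\<open>\<nu>\<close>h \<le> \<open>\<nu>\<close>K |q|^2.\<close>
  define c where "c = (A * C - B\<^sup>2) / (A + C) / (2 + 2 * r\<^sup>2)"
  define E where "E = (A + C) * (2 + 2 * r\<^sup>2) + \<nu> * K"
  have nz: "(norm z)\<^sup>2 = inner (fst z) (fst z) + inner (snd z) (snd z)" for z :: "(real^'d) \<times> (real^'d)"
    by (simp add: power2_norm_eq_inner inner_prod_def)
  have r2: "2 + 2 * r\<^sup>2 > 0" by (smt (verit) zero_le_power2)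
  show ?thesis
  proof (rule exponentially_stableI[where V = V and V' = V' and c = c and C = E])
    show "r \<ge> 0" using assms(4) by simp
    show "continuous_on UNIV (\<lambda>(q, p). (p, - (2 * \<sigma>) *\<^sub>R p - grad f q))"
      unfolding case_prod_unfold
      by (intro continuous_intros continuous_on_compose2[OF cont]) auto
    show "(\<lambda>(q, p). (p, - (2 * \<sigma>) *\<^sub>R p - grad f q)) 0 = 0"
      by (simp add: zero_prod_def grad0)
    show "c > 0" using pos r2 by (auto simp: c_def)
    show "E > 0" using pos r2 K by (auto simp: E_def intro!: add_pos_nonneg)
  next
    fix z :: "(real^'d) \<times> (real^'d)"
    have "(h has_derivative (\<lambda>w. inner w (u (fst z)))) (at (fst z))"
      using dh by (simp add: gderiv_def)
    from has_derivative_compose[OF has_derivative_fst[OF has_derivative_ident] this, of UNIV]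
    have "((\<lambda>z. h (fst z)) has_derivative (\<lambda>w. inner (fst w) (u (fst z)))) (at z)" by simp
    then show "(V has_derivative V' z) (at z)"
      unfolding V_def V'_def Q_def
      by (auto intro!: derivative_eq_intros simp: fun_eq_iff inner_commute algebra_simps)
  next
    fix z :: "(real^'d) \<times> (real^'d)"
    obtain q p where z: "z = (q, p)" by force
    define P where "P = p + r *\<^sub>R q"
    have p: "p = P - r *\<^sub>R q" by (simp add: P_def)
    have g: "grad f q = u q + m *\<^sub>R q" by (simp add: u_def)
    have m: "m = M + r\<^sup>2 + 2 * r * s" by (simp add: M_def \<sigma> power2_eq_square algebra_simps)
    \<comment> \<open>This is the equation for P' = p' + r p in the sheared coordinates.\<close>
    have P': "- (2 * \<sigma>) *\<^sub>R p - grad f q + r *\<^sub>R p = - (r + 2 * s) *\<^sub>R P - M *\<^sub>R q - u q"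
      unfolding g p \<sigma> m by (simp add: vec_eq_iff algebra_simps power2_eq_square)
    have "V' z (p, - (2 * \<sigma>) *\<^sub>R p - grad f q) + 2 * r * V z
      = 2 * A * inner q P
        + 2 * B * (inner P P - 2 * s * inner q P - M * inner q q - inner (u q) q)
        + 2 * C * (- 2 * s * inner P P - M * inner q P - inner (u q) P)
        + 2 * \<nu> * (inner (u q) P - r * inner (u q) q + 2 * r * h q)"
      unfolding V'_def V_def Q_def z fst_conv snd_conv P' P_def[symmetric]
      unfolding p
      by (simp add: inner_add_left inner_add_right inner_diff_left inner_diff_right
          inner_commute[of q "u q"] inner_commute[of P "u q"] inner_commute[of P q]
          power2_eq_square algebra_simps)
    also have "\<dots> \<le> 0" by (rule diss[OF hu hb(2) uq sec])
    finally show "V' z (case z of (q, p) \<Rightarrow> (p, - (2 * \<sigma>) *\<^sub>R p - grad f q)) \<le> - 2 * r * V z"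
      by (simp add: z)
  next
    fix z :: "(real^'d) \<times> (real^'d)"
    let ?q = "fst z" and ?P = "snd z + r *\<^sub>R fst z"
    have "c * (norm z)\<^sup>2 \<le> c * ((2 + 2 * r\<^sup>2) * (inner ?q ?q + inner ?P ?P))"
      unfolding nz using pos r2 by (intro mult_left_mono sheared_norm_bounds) (auto simp: c_def)
    also have "\<dots> = (A * C - B\<^sup>2) / (A + C) * (inner ?q ?q + inner ?P ?P)"
      using r2 by (simp add: c_def)
    also have "\<dots> \<le> Q ?q ?P"
      unfolding Q_def by (rule quadratic_form_bounds(1)[OF pos(1-3)])
    also have "\<dots> \<le> V z" using hb(1) pos by (simp add: V_def)
    finally show "c * (norm z)\<^sup>2 \<le> V z" .
    have "Q ?q ?P \<le> (A + C) * (inner ?q ?q + inner ?P ?P)"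
      unfolding Q_def by (rule quadratic_form_bounds(2)[OF pos(1-3)])
    also have "\<dots> \<le> (A + C) * ((2 + 2 * r\<^sup>2) * (norm z)\<^sup>2)"
      unfolding nz using pos by (intro mult_left_mono sheared_norm_bounds) auto
    finally have "Q ?q ?P \<le> (A + C) * ((2 + 2 * r\<^sup>2) * (norm z)\<^sup>2)" .
    moreover have "2 * \<nu> * h ?q \<le> 2 * \<nu> * (K / 2 * inner ?q ?q)"
      using hb(2) pos by (intro mult_left_mono) auto
    moreover have "\<nu> * K * inner ?q ?q \<le> \<nu> * K * (norm z)\<^sup>2"
      unfolding nz using pos K by (intro mult_left_mono) auto
    ultimately show "V z \<le> E * (norm z)\<^sup>2"
      by (simp add: V_def E_def algebra_simps)
  qed
qed

end
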